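(* Let $\mathcal{F} = \{f, g\}$ be an iterated function system on $\mathbb{R}^2$ consisting of affine transformations satisfying the following conditions: (1) $f(x) = Ax + b_f$, where $b_f \in \mathbb{R}^2$, $\det(A) > 0$, and $A^2 = -cI$ for some $c \in (0, 1)$. (2) $g(x) = Sx + b_g$, where $b_g \in \mathbb{R}^2$ and $S = \pm rI$ for some $r \in (0, 1)$. (3) $c + r \le 1$. (4) The respective fixed points $z_f$ and $z_g$ of $f$ and $g$ are distinct. Then $\mathcal{F}$ satisfies the open set condition.
   Context: $A$ and $S$ are real $2\times2$ matrices and $I$ is the $2\times 2$ identity matrix. The open set condition for $\{f,g\}$: there is a non-empty open set $U\subset\mathbb{R}^2$ with $f(U)\cup g(U)\subset U$ and $f(U)\cap g(U)=\emptyset$. *)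

theory Defs
  imports "HOL-Analysis.Analysis"
begin

definition open_set_condition :: "(real^2 \<Rightarrow> real^2) \<Rightarrow> (real^2 \<Rightarrow> real^2) \<Rightarrow> bool" where
  "open_set_condition f g \<longleftrightarrow>
    (\<exists>U. open U \<and> U \<noteq> {} \<and> f ` U \<union> g ` U \<subseteq> U \<and> f ` U \<inter> g ` U = {})"

end

theory Submission
  imports Defs
begin

text \<open>
  Put the origin at the fixed point of \<open>f\<close> and let \<open>e = z_g - z_f\<close>. Since \<open>A\<^sup>2 = -c I\<close> with
  \<open>c > 0\<close>, the matrix \<open>A\<close> has no real eigenvector, so \<open>e\<close> and \<open>A e\<close> are coordinate axes. In these
  coordinates, suitably scaled,
  \<open>f (u, v) = (- c v, u)\<close> and \<open>g (u, v) = (q + \<sigma> (u - q), \<sigma> v)\<close> with \<open>\<sigma> = r\<close> or \<open>\<sigma> = - r\<close>, where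
  the scale \<open>q \<noteq> 0\<close> is free. It is enough to find an open set for this planar model
  (\<open>open_set_condition_if_model\<close>).

  For \<open>\<sigma> = r\<close> and \<open>q = 1\<close> the square \<open>(-c, 1) \<times> (-c, 1)\<close> works (\<open>model_square\<close>): \<open>f\<close> maps it
  to the column over \<open>(-c, c\<^sup>2)\<close>, and \<open>g\<close> maps it to the right of \<open>1 - r - r c\<close>. The condition
  \<open>c + r \<le> 1\<close> is exactly what separates the two.

  For \<open>\<sigma> = - r\<close> the map \<open>g\<close> turns the top of the column upside down and, if \<open>r > c\<close>, throws it below
  the square; its \<open>f\<close>-image lies beside the column, and its further images under \<open>g\<close> spiral towards
  the fixed point. Rather than describing all these images, take \<open>U\<close> to be the union of
  the sets \<open>g\<^sup>n C\<close> over \<open>n \<ge> 0\<close>. Such a \<open>U\<close> works as soon as every \<open>f (g\<^sup>n C)\<close> lies in \<open>C\<close> and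
  every \<open>g\<^sup>n C\<close> with \<open>n > 0\<close> misses \<open>C\<close> (\<open>separated_orbit_union\<close>): then \<open>f U\<close> lies in \<open>C\<close>
  and \<open>g U\<close> outside it. A union \<open>C\<close> of three rectangles, \<open>flip_cell\<close>, satisfies both conditions
  (\<open>flip_cell_return\<close>, \<open>flip_cell_escape\<close>).
\<close>

section \<open>Reduction to a planar model\<close>

definition model_f :: "real \<Rightarrow> real \<times> real \<Rightarrow> real \<times> real" where
  "model_f c p = (- c * snd p, fst p)"

definition model_g :: "real \<Rightarrow> real \<Rightarrow> real \<times> real \<Rightarrow> real \<times> real" where
  "model_g q \<sigma> p = (q + \<sigma> * (fst p - q), \<sigma> * snd p)"

lemma model_g_funpow:
  "(model_g q \<sigma> ^^ n) p = (q + \<sigma> ^ n * (fst p - q), \<sigma> ^ n * snd p)"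
  by (induction n) (simp_all add: model_g_def)

lemma open_model_g_funpow_image:
  assumes "open C" "\<sigma> \<noteq> 0"
  shows "open ((model_g q \<sigma> ^^ n) ` C)"
proof -
  have "(model_g q \<sigma> ^^ n) p = (q - \<sigma> ^ n * q, 0) + \<sigma> ^ n *\<^sub>R p" for p
    unfolding model_g_funpow by (cases p) (simp add: algebra_simps)
  then have "(model_g q \<sigma> ^^ n) ` C = (\<lambda>p. (q - \<sigma> ^ n * q, 0) + \<sigma> ^ n *\<^sub>R p) ` C"
    by (rule image_cong[OF refl])
  then show ?thesis
    using open_affinity[OF assms(1), of "\<sigma> ^ n"] assms(2) by simp
qed

lemma scaleR_mat_1_mult_vec: "(k *\<^sub>R mat 1 :: real^'n^'n) *v x = k *\<^sub>R x"
  by (simp add: scaleR_matrix_vector_assoc[symmetric])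

lemma mult_vec_twice_if_square_scalar:
  fixes A :: "real^'n^'n"
  assumes "A ** A = - (c *\<^sub>R mat 1)"
  shows "A *v (A *v x) = - c *\<^sub>R x"
proof -
  have "A ** A = (- c) *\<^sub>R mat 1" using assms by simp
  then show ?thesis by (simp only: matrix_vector_mul_assoc scaleR_mat_1_mult_vec)
qed

text \<open>
  In the plane there is a nonzero functional that kills \<open>e\<close>. Its value at \<open>A e\<close> is nonzero, and hence
  can be scaled to any number, because otherwise \<open>A e = k e\<close> and \<open>k\<^sup>2 = - c < 0\<close>.
\<close>

lemma functional_separating_image:
  fixes A :: "real^2^2" and e :: "real^2"
  assumes "e \<noteq> 0" and sq: "A ** A = - (c *\<^sub>R mat 1)" and "c > 0"
  obtains \<beta> :: "real^2 \<Rightarrow> real" where "linear \<beta>" "\<beta> e = 0" "\<beta> (A *v e) = q"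
proof -
  define \<beta>0 where "\<beta>0 p = e $ 1 * p $ 2 - e $ 2 * p $ 1" for p :: "real^2"
  have lin: "linear \<beta>0"
    by (rule linearI) (simp_all add: \<beta>0_def algebra_simps)
  have "\<beta>0 (A *v e) \<noteq> 0"
  proof
    assume 0: "\<beta>0 (A *v e) = 0"
    obtain k where k: "A *v e = k *\<^sub>R e"
    proof (cases "e $ 1 = 0")
      case True
      with assms(1) have "e $ 2 \<noteq> 0"
        by (auto simp: vec_eq_iff forall_2)
      with True 0 show ?thesis
        by (intro that[of "(A *v e) $ 2 / e $ 2"]) (auto simp: vec_eq_iff forall_2 \<beta>0_def)
    next
      case False
      with 0 show ?thesis
        by (intro that[of "(A *v e) $ 1 / e $ 1"]) (auto simp: vec_eq_iff forall_2 \<beta>0_def field_simps)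
    qed
    have "- c *\<^sub>R e = A *v (A *v e)"
      by (simp only: mult_vec_twice_if_square_scalar[OF sq])
    also have "\<dots> = (k * k) *\<^sub>R e"
      by (simp add: k matrix_vector_mult_scaleR)
    finally have "- c = k * k"
      using assms(1) by (simp del: scaleR_minus_left)
    with assms(3) zero_le_square[of k] show False by linarith
  qed
  moreover have "\<beta>0 e = 0" by (simp add: \<beta>0_def)
  moreover have "linear (\<lambda>p. q / \<beta>0 (A *v e) * \<beta>0 p)"
    by (rule linearI) (simp_all add: linear_add[OF lin] linear_scale[OF lin] distrib_left)
  ultimately show ?thesis
    by (intro that[of "\<lambda>p. q / \<beta>0 (A *v e) * \<beta>0 p"]) simp_all
qed

text \<open>
  The coordinates of \<open>x\<close> are \<open>\<beta> (A (x - z_f))\<close> and \<open>\<beta> (x - z_f)\<close>, with \<open>\<beta>\<close> as in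
  \<open>functional_separating_image\<close>. Using \<open>\<beta>\<close> twice makes the formula for \<open>f\<close> automatic: applying \<open>A\<close> moves the first coordinate
  to the second one, and \<open>A\<^sup>2 = - c I\<close> turns the second into the first. The open set is pulled back along
  the coordinate map, and the result is nonempty because \<open>z_f\<close> has coordinates \<open>(0, 0)\<close>.
\<close>

lemma open_set_condition_if_model:
  fixes f g :: "real^2 \<Rightarrow> real^2" and A :: "real^2^2"
  assumes f: "\<And>x. f x = A *v x + b_f" and sq: "A ** A = - (c *\<^sub>R mat 1)" and c: "c > 0"
    and g: "\<And>x. g x = \<sigma> *\<^sub>R x + b_g"
    and fix_f: "f z_f = z_f" and fix_g: "g z_g = z_g" and ne: "z_f \<noteq> z_g"
    and U: "open U" "(0, 0) \<in> U" "model_f c ` U \<subseteq> U" "model_g q \<sigma> ` U \<subseteq> U"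
      "model_f c ` U \<inter> model_g q \<sigma> ` U = {}"
  shows "open_set_condition f g"
proof -
  obtain \<beta> where lin: "linear \<beta>" and e: "\<beta> (z_g - z_f) = 0" "\<beta> (A *v (z_g - z_f)) = q"
    using functional_separating_image[OF _ sq c, of "z_g - z_f"] ne by auto
  define h where "h x = (\<beta> (A *v (x - z_f)), \<beta> (x - z_f))" for x
  have fx: "f x - z_f = A *v (x - z_f)" for x
    using fix_f by (simp add: f algebra_simps)
  have gx: "g x - z_f = (z_g - z_f) + \<sigma> *\<^sub>R ((x - z_f) - (z_g - z_f))" for x
    using fix_g by (simp add: g algebra_simps)
  have hf: "h (f x) = model_f c (h x)" for x
    by (simp only: h_def fx mult_vec_twice_if_square_scalar[OF sq] model_f_def)
      (simp add: linear_scale[OF lin] linear_neg[OF lin])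
  have hg: "h (g x) = model_g q \<sigma> (h x)" for x
    unfolding h_def gx model_g_def matrix_vector_right_distrib matrix_vector_mult_scaleR
      matrix_vector_mult_diff_distrib[of A "x - z_f"] linear_add[OF lin] linear_scale[OF lin]
      linear_diff[OF lin, of "x - z_f"]
      linear_diff[OF lin, of "A *v (x - z_f)"]
    using e by simp
  have "continuous_on UNIV h"
    unfolding h_def
    by (intro continuous_intros linear_continuous_on_compose[OF _ lin]
        linear_continuous_on_compose[OF _ matrix_vector_mul_linear])
  then have "open (h -` U)"
    using U(1) by (simp add: open_vimage)
  moreover have "z_f \<in> h -` U"
    using U(2) linear_0[OF lin] by (simp add: h_def)
  moreover have "f ` (h -` U) \<union> g ` (h -` U) \<subseteq> h -` U"
    using U(3,4) by (auto simp: hf hg)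
  moreover have "f ` (h -` U) \<inter> g ` (h -` U) = {}"
  proof -
    have "f x \<noteq> g y" if "h x \<in> U" "h y \<in> U" for x y
      using U(5) that hf[of x] hg[of y] by (metis disjoint_iff imageI)
    then show ?thesis by auto
  qed
  ultimately show ?thesis
    unfolding open_set_condition_def by blast
qed

section \<open>Positive ratio\<close>

lemma model_square:
  assumes c: "0 < c" "c < 1" and r: "0 < r" "r < 1" and cr: "c + r \<le> 1"
  defines "U \<equiv> {-c<..<1} \<times> {-c<..<1}"
  shows "model_f c ` U \<subseteq> U" "model_g 1 r ` U \<subseteq> U" "model_f c ` U \<inter> model_g 1 r ` U = {}"
proof -
  have f: "- c < - c * v" "- c * v < c\<^sup>2" if "- c < v" "v < 1" for v
    using that c by (auto simp: power2_eq_square intro: mult_strict_left_mono[of "-v" c c, simplified])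
  have "c\<^sup>2 < 1"
    using c by (simp add: power_less_one_iff abs_square_less_1)
  with f show "model_f c ` U \<subseteq> U"
    unfolding U_def model_f_def by (fastforce simp: image_subset_iff)
  \<comment> \<open>The extreme case \<open>u = - c\<close> amounts to \<open>(1 - c - r) (1 + c) \<ge> 0\<close>.\<close>
  have gap: "c\<^sup>2 < 1 + r * (u - 1)" if "- c < u" for u
  proof -
    have "r * (- c) < r * u" using that r by (intro mult_strict_left_mono)
    moreover have "0 \<le> (1 - c - r) * (1 + c)" using cr c by simp
    ultimately show ?thesis by (simp add: algebra_simps power2_eq_square)
  qed
  have "1 + r * (u - 1) < 1" if "u < 1" for u
    using that r by (simp add: mult_pos_neg)
  moreover have "- c < r * v" "r * v < 1" if "- c < v" "v < 1" for v
  proof -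
    have "r * (- c) < r * v" "r * c < 1 * c"
      using that r c by (blast intro: mult_strict_left_mono mult_strict_right_mono)+
    moreover have "r * v < r" using that r by simp
    ultimately show "- c < r * v" "r * v < 1" using r by linarith+
  qed
  moreover have "- c < 1 + r * (u - 1)" if "- c < u" for u
    using gap[OF that] c zero_le_power2[of c] by linarith
  ultimately show "model_g 1 r ` U \<subseteq> U"
    unfolding U_def model_g_def by (simp add: image_subset_iff)
  have "model_f c p \<noteq> model_g 1 r p'" if "p \<in> U" "p' \<in> U" for p p'
  proof -
    have "- c < snd p" "snd p < 1" "- c < fst p'"
      using that by (auto simp: U_def)
    then have "fst (model_f c p) < fst (model_g 1 r p')"
      using f(2) gap unfolding model_f_def model_g_def fst_conv by (metis order.strict_trans)
    then show ?thesis by auto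
  qed
  then show "model_f c ` U \<inter> model_g 1 r ` U = {}" by blast
qed

section \<open>Negative ratio\<close>

text \<open>
  The images of \<open>C\<close> under the powers of \<open>G\<close> may overlap one another: disjointness of \<open>F U\<close> and \<open>G U\<close>
  asks only that they avoid \<open>C\<close>, which contains all of \<open>F U\<close>.
\<close>

lemma separated_orbit_union:
  fixes F G :: "'a \<Rightarrow> 'a"
  assumes "\<And>n. F ` (G ^^ n) ` C \<subseteq> C" and "\<And>n. n > 0 \<Longrightarrow> (G ^^ n) ` C \<inter> C = {}"
  defines "U \<equiv> (\<Union>n. (G ^^ n) ` C)"
  shows "F ` U \<subseteq> U" "G ` U \<subseteq> U" "F ` U \<inter> G ` U = {}"
proof -
  have F: "F ` U \<subseteq> C" unfolding U_def image_UN using assms(1) by blast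
  have orbit: "(G ^^ n) ` C \<subseteq> U" for n unfolding U_def by blast
  have CU: "C \<subseteq> U" using orbit[of 0] by simp
  with F show "F ` U \<subseteq> U" by auto
  have G: "G ` U = (\<Union>n. (G ^^ Suc n) ` C)"
    by (simp add: U_def image_UN image_comp)
  show "G ` U \<subseteq> U" unfolding G using orbit by blast
  have "C \<inter> (\<Union>n. (G ^^ Suc n) ` C) = {}"
    using assms(2)[of "Suc _"] by blast
  with F show "F ` U \<inter> G ` U = {}" unfolding G by blast
qed

text \<open>
  The three rectangles come from the sets \<open>f (g\<^sup>n C)\<close>, according to \<open>n\<close>. An even \<open>n\<close> scales towards \<open>q\<close>
  and gives second coordinates below \<open>q\<close>, hence the first rectangle. An odd \<open>n\<close> reflects in \<open>q\<close>, so the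
  second coordinates lie above \<open>q\<close>, and the first ones are at most \<open>c r\<^sup>n\<close>: the exponents \<open>n \<ge> 3\<close> go
  into the second rectangle. The exponent \<open>n = 1\<close> reaches further to the right, up to \<open>c r\<close>, but only at
  heights above \<open>r\<^sup>2\<close>. Enlarging the second rectangle to this width would make it meet \<open>g\<^sup>2 C\<close> when
  \<open>r\<close> is close to 1 and \<open>c = 1 - r\<close>, so \<open>n = 1\<close> gets a rectangle of its own.
\<close>

definition flip_cell :: "real \<Rightarrow> real \<Rightarrow> real \<Rightarrow> (real \<times> real) set" where
  "flip_cell c r q =
    {-c<..<c\<^sup>2} \<times> {-c<..<q} \<union>
    {-(c\<^sup>2 * r)<..<c * r ^ 3} \<times> {q<..<1} \<union>
    {-(c\<^sup>2 * r)<..<c * r} \<times> {r\<^sup>2<..<1}"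

text \<open>
  These inequalities are all that the positions of the rectangles depend on. The normalization of \<open>q\<close>
  says that \<open>g\<close> reflects the left edge \<open>- c\<close> to 1, i.e. \<open>q + r (q + c) = 1\<close>. Apart from
  \<open>0 < q < 1\<close>, each inequality, multiplied by \<open>1 + r\<close> where needed, is tightest at \<open>c = 1 - r\<close> and there
  becomes the nonnegativity of a polynomial in \<open>r\<close> on the unit interval.
\<close>

lemma flip_cell_bounds:
  fixes c r q :: real
  assumes c: "0 < c" "c < 1" and r: "0 < r" "r < 1" and cr: "c + r \<le> 1"
    and q: "q * (1 + r) = 1 - r * c"
  shows "0 < q" "q < 1" "c\<^sup>2 \<le> q" "c * r \<le> q"
    and "r\<^sup>2 \<le> q + r * (q - c\<^sup>2)" "r\<^sup>2 \<le> q + r * (q - c * r)"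
    and "c\<^sup>2 \<le> q - r\<^sup>2 * (q + c)" "c * r ^ 3 \<le> q - r\<^sup>2 * (q + c\<^sup>2 * r)"
proof -
  have rc: "r * c < 1" using mult_strict_mono[of r 1 c 1] r c by simp
  have rc0: "0 < r * c" using r c by simp
  have qeq: "q = (1 - r * c) / (1 + r)" using q r by (simp add: field_simps)
  show "0 < q" using rc r by (simp add: qeq)
  show "q < 1" using rc0 r by (simp add: qeq)
  have c_le: "c \<le> 1 - r" using cr by simp
  have rc_le: "r * c \<le> r * (1 - r)" using c_le r by simp
  have cc_le: "c\<^sup>2 \<le> (1 - r)\<^sup>2" using c_le c by (intro power_mono) auto
  have r3: "r ^ 3 \<le> r\<^sup>2" using r by (intro power_decreasing) auto
  have "c\<^sup>2 * (1 + r) \<le> (1 - r)\<^sup>2 * (1 + r)" using cc_le r by (intro mult_right_mono) auto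
  moreover have "(1 - r)\<^sup>2 * (1 + r) = 1 - r - r\<^sup>2 + r ^ 3" "r * (1 - r) = r - r\<^sup>2"
    by (simp_all add: algebra_simps power2_eq_square power3_eq_cube)
  ultimately have "c\<^sup>2 * (1 + r) \<le> 1 - r * c"
    using rc_le r3 zero_le_power2[of r] by linarith
  then show "c\<^sup>2 \<le> q" using r by (simp add: qeq field_simps)
  have "r * c * (2 + r) \<le> r * (1 - r) * (2 + r)" using rc_le r by (intro mult_right_mono) auto
  moreover have "0 \<le> (1 - r)\<^sup>2 + r ^ 3" using r by simp
  ultimately have "c * r * (1 + r) \<le> 1 - r * c"
    by (simp add: algebra_simps power2_eq_square power3_eq_cube)
  then show "c * r \<le> q" using r by (simp add: qeq field_simps)
  have "r * c\<^sup>2 \<le> r * (1 - r)\<^sup>2" using cc_le r by simp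
  moreover have "0 \<le> (1 - r) * (1 - r + r\<^sup>2)" using r by simp
  ultimately show "r\<^sup>2 \<le> q + r * (q - c\<^sup>2)"
    using q rc_le by (simp add: algebra_simps power2_eq_square)
  have "r * (r * c) \<le> r * (r * (1 - r))" using rc_le r by simp
  moreover have "0 \<le> (1 - r) * (1 - r\<^sup>2)" using r by (simp add: power_le_one)
  ultimately show "r\<^sup>2 \<le> q + r * (q - c * r)"
    using q rc_le by (simp add: algebra_simps power2_eq_square)
  have qr: "q - r\<^sup>2 * q = (1 - r * c) * (1 - r)"
    unfolding q[symmetric] by (simp add: algebra_simps power2_eq_square)
  have "0 \<le> (1 - r - c) * (1 + c)" using cr c by simp
  then show "c\<^sup>2 \<le> q - r\<^sup>2 * (q + c)"
    using qr by (simp add: algebra_simps power2_eq_square)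
  have "c * (r + r ^ 3) \<le> (1 - r) * (r + r ^ 3)" using c_le r by (intro mult_right_mono) auto
  moreover have "0 \<le> (1 - r) * (1 + r\<^sup>2 - r ^ 3)"
    using r r3 by (intro mult_nonneg_nonneg) linarith+
  ultimately have "0 \<le> 1 - r * c - c * r ^ 3 - r ^ 3"
    by (simp add: algebra_simps power2_eq_square power3_eq_cube)
  then have "0 \<le> c * (1 - r * c - c * r ^ 3 - r ^ 3)" using c by simp
  moreover have "(1 - r * c) * c \<le> (1 - r * c) * (1 - r)"
    using c_le rc by (intro mult_left_mono) auto
  ultimately show "c * r ^ 3 \<le> q - r\<^sup>2 * (q + c\<^sup>2 * r)"
    using qr by (simp add: algebra_simps power2_eq_square power3_eq_cube)
qed

text \<open>
  The last two facts are the finer information about a point of the cell: it lies far enough to the left for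
  its reflection to land above height \<open>r\<^sup>2\<close>, and if it is high, it is not close to the left edge \<open>- c\<close>.
\<close>

lemma flip_cell_coordinates:
  assumes c: "0 < c" "c < 1" and r: "0 < r" "r < 1" and cr: "c + r \<le> 1"
    and q: "q * (1 + r) = 1 - r * c" and uv: "(u, v) \<in> flip_cell c r q"
  shows "- c < u" "u < q" "- c < v" "v < 1" "r\<^sup>2 < q + r * (q - u)"
    and "v < q \<or> - (c\<^sup>2 * r) < u"
proof -
  note b = flip_cell_bounds[OF c r cr q]
  have c2r: "c\<^sup>2 * r \<le> c" using c r
    by (simp add: power2_eq_square mult_le_one mult.assoc mult_left_le)
  have cr3: "c * r ^ 3 \<le> c * r" using c r power_decreasing[of 1 3 r] by simp
  have "- c < q" "- c < r\<^sup>2" using c(1) b(1) by (auto intro: order.strict_trans2[of _ 0])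
  then show "- c < u" "- c < v" "v < 1" using uv c2r b(2)
    unfolding flip_cell_def by auto
  have u: "u < c\<^sup>2 \<or> u < c * r" using uv cr3 unfolding flip_cell_def by auto
  then show "u < q" using b(3,4) by auto
  from u have "r * u < r * c\<^sup>2 \<or> r * u < r * (c * r)" using r by simp
  then show "r\<^sup>2 < q + r * (q - u)" using b(5,6) by (auto simp: right_diff_distrib)
  show "v < q \<or> - (c\<^sup>2 * r) < u" using uv unfolding flip_cell_def by auto
qed

text \<open>
  The parity of \<open>n\<close> and the distinction between \<open>n = 1\<close> and \<open>n \<ge> 3\<close> select the rectangle that
  receives the image.
\<close>

lemma flip_cell_return:
  assumes c: "0 < c" "c < 1" and r: "0 < r" "r < 1" and cr: "c + r \<le> 1"
    and q: "q * (1 + r) = 1 - r * c"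
  shows "model_f c ` (model_g q (-r) ^^ n) ` flip_cell c r q \<subseteq> flip_cell c r q"
proof -
  note b = flip_cell_bounds[OF c r cr q]
  have "(- c * ((-r) ^ n * v), q + (-r) ^ n * (u - q)) \<in> flip_cell c r q"
    if uv: "(u, v) \<in> flip_cell c r q" for u v
  proof -
    note p = flip_cell_coordinates[OF c r cr q uv]
    define s where "s = r ^ n"
    have s: "0 < s" "s \<le> 1" using r by (auto simp: s_def power_le_one)
    have sv: "- c * s < s * v" "s * v < s"
      using mult_strict_left_mono[OF p(3) s(1)] p(4) s(1) by (simp_all add: mult.commute)
    have csv: "- (c\<^sup>2 * s) < c * (s * v)" "c * (s * v) < c * s"
      using mult_strict_left_mono[OF sv(1) c(1)] mult_strict_left_mono[OF sv(2) c(1)]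
      by (simp_all add: power2_eq_square mult_ac)
    have squ: "0 < s * (q - u)" using s p(2) by simp
    show ?thesis
    proof (cases "even n")
      case True
      have "c\<^sup>2 * s \<le> c\<^sup>2" "c * s \<le> c" using s c by (auto simp: mult_left_le)
      moreover have "s * (q - u) \<le> q - u" using s p(2) by (simp add: mult_left_le_one_le)
      ultimately show ?thesis
        using True csv squ p(1) by (auto simp: flip_cell_def s_def right_diff_distrib)
    next
      case False
      have sr: "s \<le> r" using False r power_decreasing[of 1 n r] odd_pos
        by (fastforce simp: s_def Suc_le_eq)
      have low: "- (c\<^sup>2 * r) < c * (s * v)"
        using csv(1) mult_left_mono[OF sr, of "c\<^sup>2"] by simp
      have "s * (q - u) < r * (q + c)"
        using sr p(1,2) b(1) s by (intro mult_le_less_imp_less) auto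
      then have top: "q + s * (q - u) < 1" using q by (simp add: algebra_simps)
      consider "n = 1" | "n \<ge> 3" using False by (metis One_nat_def Suc_leI even_zero
            le_neq_implies_less numeral_2_eq_2 numeral_3_eq_3 not_less_eq_eq even_numeral not_gr_zero)
      then show ?thesis
      proof cases
        case 1
        then show ?thesis
          using low csv(2) top p(5) by (auto simp: flip_cell_def s_def right_diff_distrib)
      next
        case 2
        then have "s \<le> r ^ 3" unfolding s_def using r by (intro power_decreasing) auto
        then have "c * s \<le> c * r ^ 3" using c by simp
        then show ?thesis
          using False low csv(2) top squ by (auto simp: flip_cell_def s_def right_diff_distrib)
      qed
    qed
  qed
  then show ?thesis by (auto simp: model_f_def model_g_funpow)
qed

text \<open>
  Odd powers of \<open>g\<close> reflect the cell, which lies to the left of \<open>q\<close>, to the right of \<open>q\<close>. Even powers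
  from 2 on shrink it towards \<open>q\<close>, which moves it to the right of \<open>c\<^sup>2\<close>, away from the first rectangle.
  Images of points below \<open>q\<close> are then too low for the other two rectangles; images of points with
  second coordinate at least \<open>q\<close> are too far right for the second rectangle and, staying below
  \<open>r\<^sup>2\<close>, too low for the third.
\<close>

lemma flip_cell_escape:
  assumes c: "0 < c" "c < 1" and r: "0 < r" "r < 1" and cr: "c + r \<le> 1"
    and q: "q * (1 + r) = 1 - r * c" and n: "n > 0"
  shows "(model_g q (-r) ^^ n) ` flip_cell c r q \<inter> flip_cell c r q = {}"
proof -
  note b = flip_cell_bounds[OF c r cr q]
  have "(q + (-r) ^ n * (u - q), (-r) ^ n * v) \<notin> flip_cell c r q"
    if uv: "(u, v) \<in> flip_cell c r q" for u v
  proof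
    assume image: "(q + (-r) ^ n * (u - q), (-r) ^ n * v) \<in> flip_cell c r q"
    note p = flip_cell_coordinates[OF c r cr q uv]
    define s where "s = r ^ n"
    have s: "0 < s" using r by (auto simp: s_def)
    show False
    proof (cases "even n")
      case False
      have "0 < s * (q - u)" using s p(2) by simp
      then show False
        using False flip_cell_coordinates(2)[OF c r cr q image] by (simp add: s_def algebra_simps)
    next
      case True
      have "n \<ge> 2" using True n by (cases n) (auto elim: oddE)
      then have sr: "s \<le> r\<^sup>2" unfolding s_def using r by (intro power_decreasing) auto
      have x: "q - r\<^sup>2 * (q + t) < q - s * (q - u)" if "- t < u" for t
      proof -
        have "s * (q - u) < r\<^sup>2 * (q + t)"
          using sr p(2) s that by (intro mult_le_less_imp_less) auto
        then show ?thesis by simp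
      qed
      have r1: "r\<^sup>2 < 1" using r by (simp add: power_less_one_iff)
      have sv: "s * v < s" using s p(4) by simp
      have im: "(q - s * (q - u), s * v) \<in> flip_cell c r q"
        using image True by (simp add: s_def algebra_simps)
      have right: "c\<^sup>2 < q - s * (q - u)" using x[OF p(1)] b(7) by simp
      show False
      proof (cases "v < q")
        case True
        have "s * v < s * q" using True s by simp
        also have "s * q \<le> r\<^sup>2 * q" using sr b(1) by simp
        finally have "s * v < r\<^sup>2 * q" .
        moreover have "r\<^sup>2 * q \<le> q" "r\<^sup>2 * q \<le> r\<^sup>2"
          using r1 b(1,2) by (simp_all add: mult_left_le mult_left_le_one_le)
        ultimately have "s * v < q" "s * v < r\<^sup>2" by linarith+
        with right im show False by (auto simp: flip_cell_def)
      next
        case False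
        then have "c * r ^ 3 < q - s * (q - u)" using x[of "c\<^sup>2 * r"] p(6) b(8) by simp
        moreover have "s * v < r\<^sup>2" using sv sr by simp
        ultimately show False using right im by (auto simp: flip_cell_def)
      qed
    qed
  qed
  then show ?thesis by (auto simp: model_g_funpow)
qed

theorem theorem6p3:
  fixes f g :: "real^2 \<Rightarrow> real^2"
    and A S :: "real^2^2"
    and b_f b_g z_f z_g :: "real^2"
    and c r :: real
  assumes f: "\<And>x. f x = A *v x + b_f"
    and det_A: "det A > 0"
    and A_sq: "A ** A = - (c *\<^sub>R mat 1)"
    and c: "c \<in> {0<..<1}"
    and g: "\<And>x. g x = S *v x + b_g"
    and S: "S = r *\<^sub>R mat 1 \<or> S = - (r *\<^sub>R mat 1)"
    and r: "r \<in> {0<..<1}"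
    and c_r: "c + r \<le> 1"
    and z_f: "f z_f = z_f"
    and z_g: "g z_g = z_g"
    and distinct: "z_f \<noteq> z_g"
  shows "open_set_condition f g"
proof -
  have c': "0 < c" "c < 1" and r': "0 < r" "r < 1" using c r by auto
  from S show ?thesis
  proof
    assume "S = r *\<^sub>R mat 1"
    then have g': "g x = r *\<^sub>R x + b_g" for x by (simp only: g scaleR_mat_1_mult_vec)
    show ?thesis
      by (rule open_set_condition_if_model[OF f A_sq c'(1) g' z_f z_g distinct _ _ model_square[OF c' r' c_r]])
        (use c' in \<open>auto intro: open_Times\<close>)
  next
    assume "S = - (r *\<^sub>R mat 1)"
    then have "S = (- r) *\<^sub>R mat 1" by simp
    then have g': "g x = (- r) *\<^sub>R x + b_g" for x by (simp only: g scaleR_mat_1_mult_vec)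
    define q where "q = (1 - r * c) / (1 + r)"
    have q: "q * (1 + r) = 1 - r * c" using r' by (simp add: q_def)
    define C where "C = flip_cell c r q"
    define U where "U = (\<Union>n. (model_g q (- r) ^^ n) ` C)"
    have "open C" unfolding C_def flip_cell_def by (intro open_Un open_Times) auto
    then have "open U" unfolding U_def
      using r' by (intro open_UN ballI open_model_g_funpow_image) auto
    moreover have "(0, 0) \<in> C"
      using c' flip_cell_bounds(1)[OF c' r' c_r q] by (simp add: C_def flip_cell_def)
    then have "(0, 0) \<in> U" unfolding U_def by (auto intro!: exI[of _ 0])
    moreover note separated_orbit_union[of "model_f c" "model_g q (- r)" C,
        OF flip_cell_return[OF c' r' c_r q, folded C_def] flip_cell_escape[OF c' r' c_r q, folded C_def],
        folded U_def]
    ultimately show ?thesis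
      by (rule open_set_condition_if_model[OF f A_sq c'(1) g' z_f z_g distinct])
  qed
qed

end
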